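(* Assume that $\eta$ is reversible for $L$, i.e. $\eta(x)L(x,y)=\eta(y)L(y,x)$ for all $x,y\in S$. Then for any $t\ge0$, $$\sup_{\mu_0\in\mathcal P}\|\mu_t-\nu\|_{\mathrm{tv}}\ \le\ \sqrt{\frac{1}{(\varphi^2\eta)_\wedge}}\ \frac{\varphi_\vee}{\varphi_\wedge}\,\exp(-(\lambda_2-\lambda_1)t)\ \le\ \sqrt{\frac1{\eta_\wedge}}\left(\frac{\varphi_\vee}{\varphi_\wedge}\right)^2\exp(-(\lambda_2-\lambda_1)t),$$ where $\mathcal P$ is the set of probability measures on $S$.
   Context: Let $S$ be a finite set with at least two elements, $\bar S=S\sqcup\{\infty\}$, and let $\bar L=(\bar L(x,y))_{x,y\in\bar S}$ be a Markov generator on $\bar S$ (nonnegative off-diagonal entries, zero row sums) for which $\infty$ is absorbing. Put $V(x)=\bar L(x,\infty)\ge 0$ for $x\in S$; $V$ also denotes the diagonal matrix (multiplication operator). Let $L$ be the Markov generator on $S$ such that the $S\times S$ block of $\bar L$ is $L-V$. Standing assumption: $L$ is irreducible. Measures are row vectors, functions are column vectors, and $m[f]=\sum_x m(x)f(x)$. For a probability measure $\mu_0$ on $S$ and $t\ge0$, $\mu_t$ is the probability measure on $S$ given by $\mu_t[f]=\dfrac{\mu_0\,[e^{t(L-V)}f]}{\mu_0\,[e^{t(L-V)}\mathbf 1_S]}$ for $f:S\to\mathbb R$ (the law at time $t$ of the process with generator $\bar L$ started from $\mu_0$, conditioned on not being absorbed by time $t$). The quasi-stationary measure $\nu$ is the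 unique probability measure on $S$ such that $\mu_0=\nu$ implies $\mu_t=\nu$ for all $t\geq 0$. Let $\eta$ be the unique invariant probability measure of $L$ (it charges every point). When $\eta$ is reversible for $L$, $V-L$ is self-adjoint in $\mathbb L^2(\eta)$, hence diagonalizable over $\mathbb R$; $\lambda_1$ denotes its smallest eigenvalue (simple, by Perron–Frobenius) and $\lambda_2>\lambda_1$ its next eigenvalue. Let $\varphi>0$ on $S$ satisfy $(L-V)\varphi=-\lambda_1\varphi$, normalized by $\eta[\varphi^2]=1$. For a positive function $f$ on $S$, $f_\wedge=\min_S f$ and $f_\vee=\max_S f$; in particular $(\varphi^2\eta)_\wedge=\min_{x\in S}\varphi(x)^2\eta(x)$ and $\eta_\wedge=\min_{x\in S}\eta(x)$. For a signed measure $m$ on $S$ with $m(S)=0$, $\|m\|_{\mathrm{tv}}=\sum_{x\in S}|m(x)|$. *)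

theory Defs
  imports "HOL-Analysis.Analysis"
begin

text \<open>
  The finite state space \<open>S\<close> is a type \<open>'s\<close> of class \<open>finite\<close>, and
  \<open>S\<close> with the cemetery point \<open>\<infinity>\<close> added is \<open>'s option\<close>, with \<open>None\<close> for \<open>\<infinity>\<close>.
  Functions and (signed) measures on \<open>S\<close> are both vectors \<open>real ^ 's\<close>; a measure is given by
  its point masses. The entry \<open>A(x,y)\<close> of a matrix is \<open>A $ x $ y\<close>.
\<close>

definition markov_generator :: "real ^ 'a ^ 'a::finite \<Rightarrow> bool" where
  "markov_generator A \<longleftrightarrow>
     (\<forall>x y. x \<noteq> y \<longrightarrow> 0 \<le> A $ x $ y) \<and> (\<forall>x. (\<Sum>y\<in>UNIV. A $ x $ y) = 0)"

definition absorbing_state :: "real ^ 'a ^ 'a::finite \<Rightarrow> 'a \<Rightarrow> bool" where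
  "absorbing_state A x \<longleftrightarrow> (\<forall>y. A $ x $ y = 0)"

definition irreducible_generator :: "real ^ 'a ^ 'a::finite \<Rightarrow> bool" where
  "irreducible_generator A \<longleftrightarrow> (\<forall>x y. (x, y) \<in> {(u, v). 0 < A $ u $ v}\<^sup>*)"

definition diag :: "real ^ 'a \<Rightarrow> real ^ 'a ^ 'a::finite" where
  "diag v = (\<chi> x y. if x = y then v $ x else 0)"

definition killing_rate :: "real ^ 's option ^ 's option \<Rightarrow> real ^ 's::finite" where
  "killing_rate Lbar = (\<chi> x. Lbar $ Some x $ None)"

text \<open>The generator \<open>L\<close> for which the \<open>S \<times> S\<close> block of \<open>Lbar\<close> is \<open>L - V\<close>.\<close>

definition unkilled_generator :: "real ^ 's option ^ 's option \<Rightarrow> real ^ 's ^ 's::finite" where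
  "unkilled_generator Lbar = (\<chi> x y. Lbar $ Some x $ Some y) + diag (killing_rate Lbar)"

text \<open>\<open>expect m f\<close> is \<open>m[f]\<close>.\<close>

definition expect :: "real ^ 's \<Rightarrow> real ^ 's::finite \<Rightarrow> real" where
  "expect m f = (\<Sum>x\<in>UNIV. m $ x * f $ x)"

definition prob_measures :: "(real ^ 's::finite) set" where
  "prob_measures = {m. (\<forall>x. 0 \<le> m $ x) \<and> (\<Sum>x\<in>UNIV. m $ x) = 1}"

definition tv_norm :: "real ^ 's::finite \<Rightarrow> real" where
  "tv_norm m = (\<Sum>x\<in>UNIV. \<bar>m $ x\<bar>)"

definition invariant_measure :: "real ^ 's ^ 's::finite \<Rightarrow> real ^ 's \<Rightarrow> bool" where
  "invariant_measure A m \<longleftrightarrow> m v* A = 0"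

definition reversible_measure :: "real ^ 's ^ 's::finite \<Rightarrow> real ^ 's \<Rightarrow> bool" where
  "reversible_measure A m \<longleftrightarrow> (\<forall>x y. m $ x * A $ x $ y = m $ y * A $ y $ x)"

text \<open>
  The operations \<open>*\<close> and \<open>^\<close> on \<open>real ^ 'a ^ 'a\<close> are componentwise, and the library's \<open>exp\<close>
  does not apply to this type.
\<close>

primrec matrix_power :: "real ^ 'a ^ 'a::finite \<Rightarrow> nat \<Rightarrow> real ^ 'a ^ 'a" where
  "matrix_power A 0 = mat 1"
| "matrix_power A (Suc n) = A ** matrix_power A n"

definition matrix_exp :: "real ^ 'a ^ 'a::finite \<Rightarrow> real ^ 'a ^ 'a" where
  "matrix_exp A = (\<Sum>n. (1 / fact n) *\<^sub>R matrix_power A n)"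

text \<open>
  For \<open>Q = L - V\<close> and initial law \<open>m\<close>, this is the law at time \<open>t\<close> conditioned on survival;
  the lemma \<open>expect_conditioned_law\<close> below gives its value on every function.
\<close>

definition conditioned_law :: "real ^ 's ^ 's::finite \<Rightarrow> real ^ 's \<Rightarrow> real \<Rightarrow> real ^ 's" where
  "conditioned_law Q m t =
     (\<chi> y. expect m (matrix_exp (t *\<^sub>R Q) *v axis y 1) / expect m (matrix_exp (t *\<^sub>R Q) *v vec 1))"

lemma expect_conditioned_law:
  "expect (conditioned_law Q m t) f =
     expect m (matrix_exp (t *\<^sub>R Q) *v f) / expect m (matrix_exp (t *\<^sub>R Q) *v vec 1)"
proof -
  let ?E = "matrix_exp (t *\<^sub>R Q)"
  have "expect m (?E *v f) = (\<Sum>y\<in>UNIV. expect m (?E *v axis y 1) * f $ y)"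
    unfolding expect_def matrix_vector_mult_basis column_def
    by (simp add: matrix_vector_mult_def sum_distrib_left sum_distrib_right mult.assoc)
       (rule sum.swap)
  moreover have "expect (conditioned_law Q m t) f =
      (\<Sum>y\<in>UNIV. expect m (?E *v axis y 1) * f $ y) / expect m (?E *v vec 1)"
    unfolding expect_def[of "conditioned_law Q m t"] by (simp add: conditioned_law_def sum_divide_distrib)
  ultimately show ?thesis
    by simp
qed

definition is_quasi_stationary :: "real ^ 's ^ 's::finite \<Rightarrow> real ^ 's \<Rightarrow> bool" where
  "is_quasi_stationary Q n \<longleftrightarrow>
     n \<in> prob_measures \<and> (\<forall>t\<ge>0. conditioned_law Q n t = n)"

definition quasi_stationary_measure :: "real ^ 's ^ 's::finite \<Rightarrow> real ^ 's" where
  "quasi_stationary_measure Q = (THE n. is_quasi_stationary Q n)"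

definition eigenvalues :: "real ^ 'a ^ 'a::finite \<Rightarrow> real set" where
  "eigenvalues A = {l. \<exists>f. f \<noteq> 0 \<and> A *v f = l *\<^sub>R f}"

end

theory Submission
  imports Defs
begin

text \<open>
  Write \<open>Q = L - V\<close>. Since \<open>Q\<close> is self-adjoint in \<open>L\<^sup>2(\<eta>)\<close>, the quasi-stationary measure is
  \<open>\<nu> = \<phi>\<eta> / \<eta>[\<phi>]\<close>. For a test function \<open>f\<close> with values in \<open>[-1, 1]\<close>, the function \<open>g = f - \<nu>[f]\<close> is
  orthogonal to \<open>\<phi>\<close>, and \<open>\<mu>\<^sub>t[f] - \<nu>[f]\<close> is the quotient of \<open>\<mu>\<^sub>0[e\<^sup>t\<^sup>Q g]\<close> by \<open>\<mu>\<^sub>0[e\<^sup>t\<^sup>Q 1]\<close>. In the numerator,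
  the \<open>L\<^sup>2(\<eta>)\<close> norm of \<open>e\<^sup>t\<^sup>Q g\<close> is at most \<open>exp(- \<lambda>\<^sub>2 t)\<close> times that of \<open>g\<close>, and it controls the values
  pointwise as \<open>\<bar>u(x)\<bar> \<le> \<phi>(x) \<parallel>u\<parallel> / sqrt((\<phi>\<^sup>2\<eta>)\<^sub>\<and>)\<close>. In the denominator, positivity of \<open>e\<^sup>t\<^sup>Q\<close> gives the
  lower bound \<open>exp(- \<lambda>\<^sub>1 t) \<mu>\<^sub>0[\<phi>] / \<phi>\<^sub>\<or>\<close>. The factor \<open>\<mu>\<^sub>0[\<phi>]\<close> cancels. Finally \<open>\<nu>[g\<^sup>2] \<le> 1\<close> and
  \<open>\<phi>\<^sub>\<and> \<le> 1\<close> give \<open>\<parallel>g\<parallel> \<le> 1 / \<phi>\<^sub>\<and>\<close>.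
\<close>

section \<open>Spectral theorem for self-adjoint maps and reversible matrices\<close>

text \<open>By compactness \<open>f x \<bullet> x\<close> has a maximizer \<open>v\<close> on the
  unit sphere of \<open>U\<close>. The residual \<open>w = f v - k v\<close> must vanish, since
  otherwise moving \<open>v\<close> along \<open>w\<close> would raise the Rayleigh quotient to
  first order.\<close>

lemma selfadjoint_eigenvector_in_subspace:
  fixes f :: "'a::euclidean_space \<Rightarrow> 'a"
  assumes "linear f" and sa: "\<And>x y. f x \<bullet> y = x \<bullet> f y"
    and U: "subspace U" "\<And>x. x \<in> U \<Longrightarrow> f x \<in> U" and "\<not> U \<subseteq> {0}"
  obtains v k where "v \<in> U" "norm v = 1" "f v = k *\<^sub>R v"
proof -
  interpret f: linear f by fact
  define K where "K = sphere 0 1 \<inter> U"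
  obtain a where a: "a \<in> U" "a \<noteq> 0"
    using assms(5) by blast
  have "compact K"
    unfolding K_def by (intro compact_Int_closed closed_subspace U) auto
  moreover have "a /\<^sub>R norm a \<in> K"
    using a U by (simp add: K_def subspace_scale)
  hence "K \<noteq> {}" by blast
  moreover have "continuous_on K (\<lambda>x. f x \<bullet> x)"
    by (intro continuous_intros linear_continuous_on_compose[OF _ assms(1)])
  ultimately obtain v where v: "v \<in> K" and max: "\<And>y. y \<in> K \<Longrightarrow> f y \<bullet> y \<le> f v \<bullet> v"
    using continuous_attains_sup[of K "\<lambda>x. f x \<bullet> x"] by blast
  define k where "k = f v \<bullet> v"
  define w where "w = f v - k *\<^sub>R v"
  have vv: "v \<in> U" "v \<bullet> v = 1" "norm v = 1"
    using v by (auto simp: K_def dot_square_norm)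
  have "w \<in> U"
    unfolding w_def using U vv by (intro subspace_diff subspace_scale) auto
  have le: "f x \<bullet> x \<le> k * (x \<bullet> x)" if "x \<in> U" for x
  proof (cases "x = 0")
    case False
    hence "x /\<^sub>R norm x \<in> K"
      using that U by (simp add: K_def subspace_scale)
    from max[OF this] False show ?thesis
      by (simp add: f.scale k_def field_simps dot_square_norm power2_eq_square)
  qed (simp add: f.zero)
  have "w \<bullet> w \<le> 0"
  proof (rule ccontr)
    assume "\<not> w \<bullet> w \<le> 0"
    hence pos: "w \<bullet> w > 0" by auto
    define g where "g = k * (w \<bullet> w) - f w \<bullet> w"
    have "g \<ge> 0" using le[OF \<open>w \<in> U\<close>] by (simp add: g_def)
    have vw: "f v \<bullet> w = w \<bullet> w + k * (v \<bullet> w)"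
      by (simp add: w_def inner_diff_left inner_diff_right inner_commute algebra_simps)
    \<comment> \<open>This is \<open>le\<close> at \<open>v + s w\<close>: the terms of order zero
      cancel, and the part of order one that survives is
      \<open>2 * s * (w \<bullet> w)\<close>.\<close>
    have *: "2 * s * (w \<bullet> w) \<le> s\<^sup>2 * g" for s
    proof -
      have "v + s *\<^sub>R w \<in> U"
        using U vv \<open>w \<in> U\<close> by (intro subspace_add subspace_scale)
      from le[OF this] vw sa[of w v] show ?thesis
        by (simp add: f.add f.scale inner_add_left inner_add_right g_def vv power2_eq_square
            inner_commute[of w v] inner_commute[of w "f v"] algebra_simps flip: k_def)
    qed
    \<comment> \<open>Small enough that \<open>s * g \<le> w \<bullet> w\<close>; the
      \<open>+ 1\<close> covers the case \<open>g = 0\<close>.\<close>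
    define s where "s = (w \<bullet> w) / (g + 1)"
    have "s > 0" using pos \<open>g \<ge> 0\<close> by (simp add: s_def)
    hence "2 * (w \<bullet> w) \<le> s * g"
      using *[of s] by (simp add: power2_eq_square)
    also have "\<dots> \<le> w \<bullet> w"
      using pos \<open>g \<ge> 0\<close> by (simp add: s_def field_simps)
    finally show False using pos by simp
  qed
  hence "w = 0"
    using inner_ge_zero[of w] by (metis inner_eq_zero_iff order_antisym)
  thus thesis
    using that[of v k] vv by (simp add: w_def)
qed

text \<open>Orthonormal families of eigenvectors are bounded in size by the dimension, so a largest
  one exists. Self-adjointness makes its orthogonal complement invariant, and a nonzero complement
  would supply one more eigenvector.\<close>

lemma selfadjoint_orthonormal_eigenbasis:
  fixes f :: "'a::euclidean_space \<Rightarrow> 'a"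
  assumes "linear f" and sa: "\<And>x y. f x \<bullet> y = x \<bullet> f y"
  obtains B k where "finite B" "pairwise orthogonal B" "\<And>b. b \<in> B \<Longrightarrow> norm b = 1"
    "span B = UNIV" "\<And>b. b \<in> B \<Longrightarrow> f b = k b *\<^sub>R b"
proof -
  interpret f: linear f by fact
  define P where "P B \<longleftrightarrow> pairwise orthogonal B \<and> (\<forall>b\<in>B. norm b = 1 \<and> (\<exists>k. f b = k *\<^sub>R b))" for B
  have fin: "finite B \<and> card B \<le> DIM('a)" if "P B" for B
  proof -
    have "0 \<notin> B" using that by (auto simp: P_def)
    hence "independent B"
      using that pairwise_orthogonal_independent by (auto simp: P_def)
    thus ?thesis by (rule independent_bound)
  qed
  have "P {}" by (simp add: P_def)
  then obtain B where B: "P B" and max: "\<And>C. P C \<Longrightarrow> card C \<le> card B"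
    using ex_has_greatest_nat[of P "{}" card "Suc DIM('a)"] fin by (metis less_Suc_eq_le)
  have "span B = UNIV"
  proof (rule ccontr)
    assume "span B \<noteq> UNIV"
    then obtain a where a: "a \<noteq> 0" "\<And>x. x \<in> span B \<Longrightarrow> a \<bullet> x = 0"
      using span_not_UNIV_orthogonal by blast
    define U where "U = {x. \<forall>b\<in>B. x \<bullet> b = 0}"
    have "subspace U"
      by (auto simp: U_def subspace_def inner_add_left)
    moreover have "f x \<in> U" if "x \<in> U" for x
    proof -
      have "f x \<bullet> b = 0" if "b \<in> B" for b
      proof -
        obtain k where "f b = k *\<^sub>R b" using B \<open>b \<in> B\<close> by (auto simp: P_def)
        thus ?thesis using \<open>x \<in> U\<close> \<open>b \<in> B\<close> by (simp add: sa U_def)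
      qed
      thus ?thesis by (simp add: U_def)
    qed
    moreover have "a \<in> U" using a by (simp add: U_def span_base)
    hence "\<not> U \<subseteq> {0}" using a by blast
    ultimately obtain v k where v: "v \<in> U" "norm v = 1" "f v = k *\<^sub>R v"
      using selfadjoint_eigenvector_in_subspace[OF assms] by blast
    have "v \<notin> B" using v by (auto simp: U_def)
    moreover have "P (insert v B)"
      using B v by (auto simp: P_def U_def pairwise_insert orthogonal_def inner_commute)
    ultimately show False
      using max[of "insert v B"] fin[OF B] by simp
  qed
  moreover obtain k where "\<forall>b\<in>B. f b = k b *\<^sub>R b"
    using B unfolding P_def by metis
  ultimately show thesis
    using that[of B k] B fin[OF B] by (simp add: P_def)
qed

text \<open>Products of vectors are componentwise, so \<open>expect \<eta> (f * g)\<close> is the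
  inner product of L2(\<eta>). Detailed balance lets the two indices of the kernel \<eta>(x) Q(x,y)
  be exchanged.\<close>

lemma reversible_selfadjoint:
  assumes rev: "reversible_measure Q \<eta>"
  shows "expect \<eta> ((Q *v f) * g) = expect \<eta> (f * (Q *v g))"
proof -
  have "expect \<eta> ((Q *v f) * g) = (\<Sum>x\<in>UNIV. \<Sum>y\<in>UNIV. (\<eta> $ x * Q $ x $ y) * f $ y * g $ x)"
    by (simp add: expect_def matrix_vector_mult_def sum_distrib_left sum_distrib_right mult_ac)
  also have "\<dots> = (\<Sum>x\<in>UNIV. \<Sum>y\<in>UNIV. (\<eta> $ y * Q $ y $ x) * f $ y * g $ x)"
    using rev unfolding reversible_measure_def by (intro sum.cong refl) metis
  also have "\<dots> = (\<Sum>y\<in>UNIV. \<Sum>x\<in>UNIV. (\<eta> $ y * Q $ y $ x) * f $ y * g $ x)"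
    by (rule sum.swap)
  also have "\<dots> = expect \<eta> (f * (Q *v g))"
    by (simp add: expect_def matrix_vector_mult_def sum_distrib_left sum_distrib_right mult_ac)
  finally show ?thesis .
qed

text \<open>Multiplication by the square root of \<eta> is an isometry \<open>T\<close> from
  L2(\<eta>) onto Euclidean space. It conjugates \<open>Q\<close> to a self-adjoint map, whose
  orthonormal eigenbasis is carried back by the inverse \<open>T'\<close>.\<close>

lemma reversible_orthonormal_eigenbasis:
  fixes Q :: "real ^ 's ^ 's::finite" and \<eta> :: "real ^ 's"
  assumes pos: "\<And>x. 0 < \<eta> $ x" and rev: "reversible_measure Q \<eta>"
  obtains B k where "finite B" "\<And>b. b \<in> B \<Longrightarrow> Q *v b = k b *\<^sub>R b"
    "\<And>b c. b \<in> B \<Longrightarrow> c \<in> B \<Longrightarrow> expect \<eta> (b * c) = (if b = c then 1 else 0)"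
    "\<And>f. (\<Sum>b\<in>B. expect \<eta> (f * b) *\<^sub>R b) = f"
proof -
  define r where "r x = sqrt (\<eta> $ x)" for x
  have r: "r x > 0" "r x * r x = \<eta> $ x" for x
    using pos[of x] by (simp_all add: r_def less_imp_le)
  define T where "T f = (\<chi> x. r x * f $ x)" for f :: "real ^ 's"
  define T' where "T' f = (\<chi> x. f $ x / r x)" for f :: "real ^ 's"
  have TT: "T (T' f) = f" "T' (T f) = f" for f
    using r(1) by (simp_all add: T_def T'_def vec_eq_iff less_imp_neq[symmetric])
  have "linear T" "linear T'"
    by (auto intro!: linearI simp: T_def T'_def vec_eq_iff algebra_simps add_divide_distrib)
  interpret T: linear T by fact
  interpret T': linear T' by fact
  have inner: "T f \<bullet> T g = expect \<eta> (f * g)" for f g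
    by (simp add: inner_vec_def T_def expect_def mult_ac flip: r(2))
  note sa = reversible_selfadjoint[OF rev]
  define A where "A f = T (Q *v T' f)" for f
  have "linear A"
    unfolding A_def
    by (auto intro!: linearI simp: T.add T'.add T.scale T'.scale matrix_vector_right_distrib matrix_vector_mult_scaleR)
  moreover have "A f \<bullet> g = f \<bullet> A g" for f g
  proof -
    have "A f \<bullet> g = T (Q *v T' f) \<bullet> T (T' g)" by (simp add: A_def TT)
    also have "\<dots> = T (T' f) \<bullet> T (Q *v T' g)" by (simp only: inner sa)
    finally show ?thesis by (simp add: A_def TT)
  qed
  ultimately obtain B k where B: "finite B" "pairwise orthogonal B" "\<And>b. b \<in> B \<Longrightarrow> norm b = 1"
    "span B = UNIV" "\<And>b. b \<in> B \<Longrightarrow> A b = k b *\<^sub>R b"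
    using selfadjoint_orthonormal_eigenbasis by metis
  show thesis
  proof
    show "finite (T' ` B)" using B by simp
    show "Q *v b = (k \<circ> T) b *\<^sub>R b" if "b \<in> T' ` B" for b
    proof -
      have Tb: "T b \<in> B" using that TT by auto
      have "Q *v b = T' (A (T b))" by (simp add: A_def TT)
      thus ?thesis by (simp add: B(5)[OF Tb] T'.scale TT)
    qed
    show "expect \<eta> (b * c) = (if b = c then 1 else 0)" if "b \<in> T' ` B" "c \<in> T' ` B" for b c
    proof -
      have Tb: "T b \<in> B" "T c \<in> B" using that TT by auto
      moreover have "b = c \<longleftrightarrow> T b = T c" by (metis TT(2))
      ultimately       show ?thesis using B(2,3)
        by (auto simp: pairwise_def orthogonal_def simp flip: inner) (metis dot_square_norm one_power2)
    qed
    show "(\<Sum>b\<in>T' ` B. expect \<eta> (f * b) *\<^sub>R b) = f" for f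
    proof -
      have "inj_on T' B" by (metis TT(1) inj_on_inverseI)
      hence "(\<Sum>b\<in>T' ` B. expect \<eta> (f * b) *\<^sub>R b) = (\<Sum>b\<in>B. (T f \<bullet> b) *\<^sub>R T' b)"
        by (simp add: sum.reindex TT flip: inner)
      also have "\<dots> = T' (\<Sum>b\<in>B. (T f \<bullet> b) *\<^sub>R b)"
        by (simp add: T'.sum T'.scale)
      also have "\<dots> = f"
        using B by (subst orthonormal_basis_expand) (auto simp: TT)
      finally show ?thesis .
    qed
  qed
qed

section \<open>The matrix exponential\<close>

text \<open>Serves to bound matrix powers geometrically, so that the exponential series can be
  compared with a scalar one.\<close>

lemma sum_abs_matrix_mult_le:
  fixes A B :: "real ^ 'a ^ 'a::finite"
  shows "(\<Sum>x\<in>UNIV. \<Sum>y\<in>UNIV. \<bar>(A ** B) $ x $ y\<bar>)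
    \<le> (\<Sum>x\<in>UNIV. \<Sum>y\<in>UNIV. \<bar>A $ x $ y\<bar>) * (\<Sum>x\<in>UNIV. \<Sum>y\<in>UNIV. \<bar>B $ x $ y\<bar>)"
proof -
  have "(\<Sum>x\<in>UNIV. \<Sum>y\<in>UNIV. \<bar>(A ** B) $ x $ y\<bar>)
      \<le> (\<Sum>x\<in>UNIV. \<Sum>y\<in>UNIV. \<Sum>z\<in>UNIV. \<bar>A $ x $ z\<bar> * \<bar>B $ z $ y\<bar>)"
    unfolding matrix_matrix_mult_def
    by (intro sum_mono) (simp add: order_trans[OF sum_abs] abs_mult)
  also have "\<dots> = (\<Sum>x\<in>UNIV. \<Sum>z\<in>UNIV. \<bar>A $ x $ z\<bar> * (\<Sum>y\<in>UNIV. \<bar>B $ z $ y\<bar>))"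
    unfolding sum_distrib_left by (intro sum.cong refl sum.swap)
  also have "\<dots> \<le> (\<Sum>x\<in>UNIV. \<Sum>z\<in>UNIV. \<bar>A $ x $ z\<bar> * (\<Sum>x\<in>UNIV. \<Sum>y\<in>UNIV. \<bar>B $ x $ y\<bar>))"
    by (intro sum_mono mult_left_mono member_le_sum[where f = "\<lambda>z. \<Sum>y\<in>UNIV. \<bar>B $ z $ y\<bar>"]) (auto intro: sum_nonneg)
  finally show ?thesis by (simp add: sum_distrib_right)
qed

lemma summable_matrix_exp:
  fixes A :: "real ^ 'a ^ 'a::finite"
  shows "summable (\<lambda>n. (1 / fact n) *\<^sub>R matrix_power A n)"
proof (rule summable_comparison_test')
  define N where "N M = (\<Sum>x\<in>UNIV. \<Sum>y\<in>UNIV. \<bar>M $ x $ y\<bar>)" for M :: "real ^ 'a ^ 'a"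
  have N0: "N M \<ge> 0" for M by (auto simp: N_def intro!: sum_nonneg)
  \<comment> \<open>The factor \<open>N (mat 1)\<close> appears because the entry sum of the
    identity is the number of indices.\<close>
  have "N (matrix_power A n) \<le> N (mat 1) * N A ^ n" for n
  proof (induction n)
    case (Suc n)
    have "N (matrix_power A (Suc n)) \<le> N A * N (matrix_power A n)"
      unfolding N_def matrix_power.simps by (rule sum_abs_matrix_mult_le)
    also have "\<dots> \<le> N A * (N (mat 1) * N A ^ n)"
      using Suc N0 by (intro mult_left_mono) auto
    finally show ?case by (simp add: mult_ac)
  qed simp
  moreover have "norm M \<le> N M" for M
    unfolding N_def norm_vec_def
    by (intro order_trans[OF L2_set_le_sum] sum_mono) (auto simp: L2_set_le_sum)
  ultimately show "norm ((1 / fact n) *\<^sub>R matrix_power A n) \<le> N (mat 1) * (N A ^ n /\<^sub>R fact n)" for n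
    by (simp add: field_simps) (meson order_trans)
  show "summable (\<lambda>n. N (mat 1) * (N A ^ n /\<^sub>R fact n))"
    by (intro summable_mult summable_exp_generic)
qed

text \<open>On an eigenvector every power of \<open>A\<close> acts as a scalar, so the series
  becomes the scalar exponential. Given an eigenbasis, this determines the matrix
  exponential.\<close>

lemma matrix_exp_mult_eigenvector:
  fixes A :: "real ^ 'a ^ 'a::finite"
  assumes "A *v b = k *\<^sub>R b"
  shows "matrix_exp A *v b = exp k *\<^sub>R b"
proof -
  have pow: "matrix_power A n *v b = k ^ n *\<^sub>R b" for n
    by (induction n) (simp_all add: assms matrix_vector_mult_scaleR flip: matrix_vector_mul_assoc)
  have bl: "bounded_linear (\<lambda>M::real ^ 'a ^ 'a. M *v b)"
    by (intro linear_conv_bounded_linear[THEN iffD1] linearI)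
       (simp_all add: matrix_vector_mult_add_rdistrib scaleR_matrix_vector_assoc)
  have "matrix_exp A *v b = (\<Sum>n. ((1 / fact n) *\<^sub>R matrix_power A n) *v b)"
    unfolding matrix_exp_def by (rule bounded_linear.suminf[OF bl summable_matrix_exp])
  also have "\<dots> = (\<Sum>n. (k ^ n /\<^sub>R fact n) *\<^sub>R b)"
    by (simp add: pow divide_inverse flip: scaleR_matrix_vector_assoc)
  also have "\<dots> = exp k *\<^sub>R b"
    unfolding exp_def
    by (rule bounded_linear.suminf[OF bounded_linear_scaleR_left summable_exp_generic, symmetric])
  finally show ?thesis .
qed

lemma matrix_exp_nonneg:
  fixes A :: "real ^ 'a ^ 'a::finite"
  assumes "\<And>x y. 0 \<le> A $ x $ y"
  shows "0 \<le> matrix_exp A $ x $ y"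
proof -
  have pow: "0 \<le> matrix_power A n $ x $ y" for n x y
    by (induction n arbitrary: x y)
       (auto simp: mat_def matrix_matrix_mult_def assms intro!: sum_nonneg)
  have bl: "bounded_linear (\<lambda>M::real ^ 'a ^ 'a. M $ x $ y)"
    by (intro bounded_linear_compose[OF bounded_linear_vec_nth] bounded_linear_vec_nth)
  have "matrix_exp A $ x $ y = (\<Sum>n. ((1 / fact n) *\<^sub>R matrix_power A n) $ x $ y)"
    unfolding matrix_exp_def by (rule bounded_linear.suminf[OF bl summable_matrix_exp])
  also have "\<dots> \<ge> 0"
    by (intro suminf_nonneg bounded_linear.summable[OF bl summable_matrix_exp]) (simp add: pow)
  finally show ?thesis .
qed

section \<open>Expectations and positivity of the reversible measure\<close>

lemma uminus_matrix_vector_mult: "(- A) *v x = - (A *v x)" for A :: "real ^ 'a ^ 'b::finite"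
  by (simp add: matrix_vector_mult_def vec_eq_iff sum_negf)

lemma expect_add: "expect m (f + g) = expect m f + expect m g"
  by (simp add: expect_def distrib_left sum.distrib)

lemma expect_diff: "expect m (f - g) = expect m f - expect m g"
  by (simp add: expect_def right_diff_distrib sum_subtractf)

lemma expect_scaleR: "expect m (c *\<^sub>R f) = c * expect m f"
  by (simp add: expect_def sum_distrib_left mult_ac)

lemma expect_sum: "expect m (\<Sum>i\<in>I. f i) = (\<Sum>i\<in>I. expect m (f i))"
  by (simp add: expect_def sum_distrib_left) (rule sum.swap)

lemma expect_mono:
  assumes "m \<in> prob_measures" "\<And>x. f $ x \<le> g $ x"
  shows "expect m f \<le> expect m g"
  using assms by (auto simp: expect_def prob_measures_def intro!: sum_mono mult_left_mono)

lemma expect_vec: "m \<in> prob_measures \<Longrightarrow> expect m (vec c) = c"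
  by (simp add: expect_def prob_measures_def flip: sum_distrib_right)

lemma expect_one: "m \<in> prob_measures \<Longrightarrow> expect m 1 = 1"
  by (simp add: expect_def prob_measures_def)

lemma expect_axis: "expect m (axis y 1) = m $ y"
  by (simp add: expect_def axis_def if_distrib cong: if_cong)

lemma expect_pos:
  assumes "m \<in> prob_measures" "\<And>x. 0 < f $ x"
  shows "0 < expect m f"
proof -
  obtain x where "m $ x \<noteq> 0"
    using assms(1) by (force simp: prob_measures_def)
  hence "0 < m $ x * f $ x"
    using assms by (auto simp: prob_measures_def less_le)
  thus ?thesis
    using assms unfolding expect_def prob_measures_def
    by (intro sum_pos2[of _ x]) (auto intro: mult_nonneg_nonneg less_imp_le)
qed

text \<open>Some point has positive mass. If \<open>u\<close> has positive mass and \<open>L\<close>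
  jumps from \<open>u\<close> to \<open>v\<close>, detailed balance forces positive mass at
  \<open>v\<close>; irreducibility reaches every point.\<close>

lemma irreducible_reversible_pos:
  assumes "irreducible_generator L" "\<eta> \<in> prob_measures" "reversible_measure L \<eta>"
  shows "0 < \<eta> $ x"
proof -
  have nn: "0 \<le> \<eta> $ y" for y using assms by (simp add: prob_measures_def)
  obtain z where "\<eta> $ z \<noteq> 0"
    using assms(2) by (force simp: prob_measures_def)
  hence z: "0 < \<eta> $ z" using nn[of z] by simp
  have "(z, x) \<in> {(u, v). 0 < L $ u $ v}\<^sup>*"
    using assms(1) by (simp add: irreducible_generator_def)
  thus ?thesis
  proof (induction rule: rtrancl_induct)
    case (step u v)
    hence "0 < \<eta> $ v * L $ v $ u"
      using assms(3) unfolding reversible_measure_def by (metis case_prodD mem_Collect_eq mult_pos_pos)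
    thus ?case using nn[of v] by (auto simp: less_le)
  qed (rule z)
qed

section \<open>Killed reversible generators and their ground state\<close>

text \<open>Irreducibility is stated with genuine jumps \<open>u \<noteq> v\<close>, because
  \<open>L\<close> and \<open>Q = L - V\<close> agree off the diagonal only.\<close>

locale killed_reversible =
  fixes Q :: "real ^ 's ^ 's::finite" and \<eta> \<phi> :: "real ^ 's" and lam :: real
  assumes offdiag: "x \<noteq> y \<Longrightarrow> 0 \<le> Q $ x $ y"
    and irreducible: "(x, y) \<in> {(u, v). u \<noteq> v \<and> 0 < Q $ u $ v}\<^sup>*"
    and \<eta>: "\<eta> \<in> prob_measures" and \<eta>_pos: "0 < \<eta> $ x"
    and reversible: "reversible_measure Q \<eta>"
    and \<phi>_pos: "0 < \<phi> $ x"
    and \<phi>_eigen: "Q *v \<phi> = - lam *\<^sub>R \<phi>"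
    and \<phi>_normalized: "expect \<eta> (\<phi> * \<phi>) = 1"
begin

text \<open>The Perron-Frobenius argument: subtract the largest multiple of \<phi> that leaves
  \<open>h = f - c \<phi>\<close> nonnegative. Then \<open>h\<close> has a zero, and zeros spread
  along jumps to the whole space.\<close>

lemma ground_state_simple:
  assumes "Q *v f = - lam *\<^sub>R f"
  shows "f = expect \<eta> (f * \<phi>) *\<^sub>R \<phi>"
proof -
  define c where "c = (MIN x. f $ x / \<phi> $ x)"
  define h where "h = f - c *\<^sub>R \<phi>"
  have h0: "0 \<le> h $ x" for x
  proof -
    have "c \<le> f $ x / \<phi> $ x" by (simp add: c_def)
    thus ?thesis using \<phi>_pos[of x] by (simp add: h_def field_simps)
  qed
  have Qh: "Q *v h = - lam *\<^sub>R h"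
    by (simp add: h_def matrix_vector_mult_diff_distrib matrix_vector_mult_scaleR assms \<phi>_eigen algebra_simps)
  have "c \<in> range (\<lambda>x. f $ x / \<phi> $ x)"
    unfolding c_def by (intro Min_in) auto
  then obtain x0 where "c = f $ x0 / \<phi> $ x0" by blast
  hence x0: "h $ x0 = 0" using \<phi>_pos[of x0] by (simp add: h_def)
  have "h $ x = 0" for x
    using irreducible[of x0 x]
  proof (induction rule: rtrancl_induct)
    case (step u v)
    \<comment> \<open>At a zero \<open>u\<close> of \<open>h\<close> the diagonal term drops out, so
      the eigenvalue equation is a vanishing sum of nonnegative terms.\<close>
    have "(\<Sum>y\<in>UNIV. Q $ u $ y * h $ y) = 0"
      using arg_cong[OF Qh, of "\<lambda>w. w $ u"] step.IH by (simp add: matrix_vector_mult_def)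
    moreover have "0 \<le> Q $ u $ y * h $ y" for y
      using step.IH h0 offdiag by (cases "y = u") auto
    ultimately have "Q $ u $ v * h $ v = 0"
      by (simp add: sum_nonneg_eq_0_iff)
    thus ?case using step.hyps by auto
  qed (rule x0)
  hence f: "f = c *\<^sub>R \<phi>" by (simp add: h_def vec_eq_iff)
  moreover have "expect \<eta> (f * \<phi>) = c"
    by (simp add: f expect_scaleR \<phi>_normalized)
  ultimately show ?thesis by simp
qed

section \<open>The killed semigroup: positivity and spectral gap\<close>

definition killed_semigroup :: "real \<Rightarrow> real ^ 's \<Rightarrow> real ^ 's" where
  "killed_semigroup t f = matrix_exp (t *\<^sub>R Q) *v f"

lemma semigroup_eigenvector:
  "Q *v b = k *\<^sub>R b \<Longrightarrow> killed_semigroup t b = exp (t * k) *\<^sub>R b"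
  unfolding killed_semigroup_def
  by (rule matrix_exp_mult_eigenvector) (simp flip: scaleR_matrix_vector_assoc)

lemma semigroup_ground_state: "killed_semigroup t \<phi> = exp (- lam * t) *\<^sub>R \<phi>"
  using semigroup_eigenvector[OF \<phi>_eigen] by (simp add: mult.commute)

lemma semigroup_diff: "killed_semigroup t (f - g) = killed_semigroup t f - killed_semigroup t g"
  by (simp add: killed_semigroup_def matrix_vector_mult_diff_distrib)

lemma semigroup_scaleR: "killed_semigroup t (c *\<^sub>R f) = c *\<^sub>R killed_semigroup t f"
  by (simp add: killed_semigroup_def matrix_vector_mult_scaleR)

lemma semigroup_sum: "killed_semigroup t (\<Sum>i\<in>I. f i) = (\<Sum>i\<in>I. killed_semigroup t (f i))"
  unfolding killed_semigroup_def by (rule linear_sum[OF matrix_vector_mul_linear])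

lemma eigenbasis:
  obtains B k where "finite B" "\<And>b. b \<in> B \<Longrightarrow> Q *v b = k b *\<^sub>R b"
    "\<And>b c. b \<in> B \<Longrightarrow> c \<in> B \<Longrightarrow> expect \<eta> (b * c) = (if b = c then 1 else 0)"
    "\<And>f. (\<Sum>b\<in>B. expect \<eta> (f * b) *\<^sub>R b) = f"
  by (rule reversible_orthonormal_eigenbasis[OF \<eta>_pos reversible]) blast

text \<open>Shifting \<open>Q\<close> by a multiple of the identity makes all entries nonnegative and only rescales the semigroup.\<close>

lemma semigroup_nonneg:
  assumes "0 \<le> t" "\<And>x. 0 \<le> f $ x"
  shows "0 \<le> killed_semigroup t f $ x"
proof -
  \<comment> \<open>\<open>c\<close> dominates every diagonal entry in absolute value, so
    \<open>Q + mat c\<close> has nonnegative entries.\<close>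
  define c where "c = (\<Sum>x\<in>UNIV. \<bar>Q $ x $ x\<bar>)"
  define R where "R = t *\<^sub>R (Q + mat c)"
  have c: "\<bar>Q $ y $ y\<bar> \<le> c" for y
    unfolding c_def by (rule member_le_sum) auto
  have "0 \<le> R $ y $ z" for y z
    using c[of y] offdiag[of y z] assms(1) by (auto simp: R_def mat_def)
  hence R: "0 \<le> matrix_exp R $ y $ z" for y z
    by (rule matrix_exp_nonneg)
  obtain B k where fin: "finite B" and eig: "\<And>b. b \<in> B \<Longrightarrow> Q *v b = k b *\<^sub>R b"
      and ortho: "\<And>b c. b \<in> B \<Longrightarrow> c \<in> B \<Longrightarrow> expect \<eta> (b * c) = (if b = c then 1 else 0)"
      and expand: "\<And>f. (\<Sum>b\<in>B. expect \<eta> (f * b) *\<^sub>R b) = f"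
    by (rule eigenbasis) blast
  have mat: "mat c *v b = c *\<^sub>R b" for b :: "real ^ 's"
    by (simp add: mat_def matrix_vector_mult_def vec_eq_iff if_distrib if_distribR cong: if_cong)
  \<comment> \<open>The effect of the shift is a scalar identity on each eigenvector, and the
    eigenbasis carries it to \<open>f\<close>.\<close>
  have "matrix_exp R *v b = exp (t * c) *\<^sub>R killed_semigroup t b" if "b \<in> B" for b
  proof -
    have "R *v b = (t * (k b + c)) *\<^sub>R b"
      using eig[OF that]
      by (simp add: R_def mat matrix_vector_mult_add_rdistrib algebra_simps flip: scaleR_matrix_vector_assoc)
    from matrix_exp_mult_eigenvector[OF this] show ?thesis
      by (simp add: semigroup_eigenvector[OF eig[OF that]] distrib_left exp_add mult_ac)
  qed
  hence "matrix_exp R *v f = exp (t * c) *\<^sub>R killed_semigroup t f"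
    by (subst (1 2) expand[of f, symmetric])
      (simp add: linear_sum[OF matrix_vector_mul_linear] semigroup_sum semigroup_scaleR
        matrix_vector_mult_scaleR scaleR_right.sum mult_ac)
  moreover have "0 \<le> (matrix_exp R *v f) $ x"
    using R assms by (simp add: matrix_vector_mult_def sum_nonneg)
  ultimately show ?thesis by (simp add: zero_le_mult_iff)
qed

text \<open>Pairing an eigenvector with a basis vector on which it has a nonzero coefficient shows
  that the two eigenvalues agree. Finiteness makes the minima defining the first two eigenvalues
  genuine lower bounds.\<close>

lemma finite_eigenvalues: "finite (eigenvalues (- Q))"
proof -
  obtain B k where fin: "finite B" and eig: "\<And>b. b \<in> B \<Longrightarrow> Q *v b = k b *\<^sub>R b"
      and ortho: "\<And>b c. b \<in> B \<Longrightarrow> c \<in> B \<Longrightarrow> expect \<eta> (b * c) = (if b = c then 1 else 0)"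
      and expand: "\<And>f. (\<Sum>b\<in>B. expect \<eta> (f * b) *\<^sub>R b) = f"
    by (rule eigenbasis) blast
  have "eigenvalues (- Q) \<subseteq> (\<lambda>b. - k b) ` B"
  proof
    fix l assume "l \<in> eigenvalues (- Q)"
    then obtain f where f: "f \<noteq> 0" "(- Q) *v f = l *\<^sub>R f"
      by (auto simp: eigenvalues_def)
    have Qf: "Q *v f = (- l) *\<^sub>R f"
      using f(2) by (simp add: uminus_matrix_vector_mult minus_equation_iff[of "Q *v f"])
    have "\<exists>b\<in>B. expect \<eta> (f * b) \<noteq> 0"
      using expand[of f] f(1) by (metis (no_types, lifting) scaleR_zero_left sum.neutral)
    then obtain b where b: "b \<in> B" "expect \<eta> (f * b) \<noteq> 0" by blast
    have "- l * expect \<eta> (f * b) = expect \<eta> ((Q *v f) * b)"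
      by (simp only: Qf expect_scaleR mult_scaleR_left)
    also have "\<dots> = expect \<eta> (f * (Q *v b))"
      by (rule reversible_selfadjoint[OF reversible])
    also have "\<dots> = k b * expect \<eta> (f * b)"
      by (simp only: eig[OF b(1)] expect_scaleR mult_scaleR_right)
    finally have "- l = k b" using b(2) by (metis mult_right_cancel)
    hence "l = - k b" by simp
    thus "l \<in> (\<lambda>b. - k b) ` B" using b(1) by blast
  qed
  thus ?thesis using fin finite_surj by blast
qed

lemma semigroup_expand:
  assumes "\<And>b. b \<in> B \<Longrightarrow> Q *v b = k b *\<^sub>R b" "\<And>f. (\<Sum>b\<in>B. expect \<eta> (f * b) *\<^sub>R b) = f"
  shows "killed_semigroup t f = (\<Sum>b\<in>B. (expect \<eta> (f * b) * exp (t * k b)) *\<^sub>R b)"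
  by (subst assms(2)[of f, symmetric])
     (simp add: semigroup_sum semigroup_scaleR semigroup_eigenvector[OF assms(1)])

text \<open>By self-adjointness, a basis vector either has eigenvalue \<open>- lam\<close> or is
  orthogonal to \<phi>. Read on measures, \<phi>\<eta> is a left eigenvector of the
  semigroup.\<close>

lemma expect_semigroup_ground_state:
  "expect \<eta> (killed_semigroup t f * \<phi>) = exp (- lam * t) * expect \<eta> (f * \<phi>)"
proof -
  obtain B k where fin: "finite B" and eig: "\<And>b. b \<in> B \<Longrightarrow> Q *v b = k b *\<^sub>R b"
      and ortho: "\<And>b c. b \<in> B \<Longrightarrow> c \<in> B \<Longrightarrow> expect \<eta> (b * c) = (if b = c then 1 else 0)"
      and expand: "\<And>f. (\<Sum>b\<in>B. expect \<eta> (f * b) *\<^sub>R b) = f"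
    by (rule eigenbasis) blast
  have "exp (t * k b) * expect \<eta> (b * \<phi>) = exp (- lam * t) * expect \<eta> (b * \<phi>)" if "b \<in> B" for b
  proof -
    have "k b * expect \<eta> (b * \<phi>) = expect \<eta> ((Q *v b) * \<phi>)"
      by (simp only: eig[OF that] expect_scaleR mult_scaleR_left)
    also have "\<dots> = expect \<eta> (b * (Q *v \<phi>))"
      by (rule reversible_selfadjoint[OF reversible])
    also have "\<dots> = - lam * expect \<eta> (b * \<phi>)"
      by (simp only: \<phi>_eigen expect_scaleR mult_scaleR_right)
    finally have "k b = - lam \<or> expect \<eta> (b * \<phi>) = 0"
      by (metis mult_right_cancel)
    thus ?thesis by (auto simp: mult.commute)
  qed
  note * = this
  have "expect \<eta> (killed_semigroup t f * \<phi>) =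
      (\<Sum>b\<in>B. expect \<eta> (f * b) * (exp (t * k b) * expect \<eta> (b * \<phi>)))"
    by (simp add: semigroup_expand[OF eig expand] sum_distrib_right expect_sum expect_scaleR mult.assoc)
  also have "\<dots> = (\<Sum>b\<in>B. expect \<eta> (f * b) * (exp (- lam * t) * expect \<eta> (b * \<phi>)))"
    by (simp add: *)
  also have "\<dots> = exp (- lam * t) * expect \<eta> ((\<Sum>b\<in>B. expect \<eta> (f * b) *\<^sub>R b) * \<phi>)"
    by (simp add: sum_distrib_right sum_distrib_left expect_sum expect_scaleR mult_ac)
  finally show ?thesis by (simp only: expand)
qed

text \<open>Basis vectors with eigenvalue \<open>- lam\<close> are multiples of \<phi>, so
  \<open>g\<close> has no component along them; every other component decays at least at rate
  \<open>lam2\<close>.\<close>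

lemma semigroup_contraction:
  assumes orth: "expect \<eta> (g * \<phi>) = 0" and "0 \<le> t"
    and gap: "\<And>l. l \<in> eigenvalues (- Q) \<Longrightarrow> l \<noteq> lam \<Longrightarrow> lam2 \<le> l"
  shows "expect \<eta> (killed_semigroup t g * killed_semigroup t g) \<le> (exp (- lam2 * t))\<^sup>2 * expect \<eta> (g * g)"
proof -
  obtain B k where fin: "finite B" and eig: "\<And>b. b \<in> B \<Longrightarrow> Q *v b = k b *\<^sub>R b"
      and ortho: "\<And>b c. b \<in> B \<Longrightarrow> c \<in> B \<Longrightarrow> expect \<eta> (b * c) = (if b = c then 1 else 0)"
      and expand: "\<And>f. (\<Sum>b\<in>B. expect \<eta> (f * b) *\<^sub>R b) = f"
    by (rule eigenbasis) blast
  \<comment> \<open>Parseval's identity for the eigenbasis.\<close>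
  have sq: "expect \<eta> ((\<Sum>b\<in>B. a b *\<^sub>R b) * (\<Sum>b\<in>B. a b *\<^sub>R b)) = (\<Sum>b\<in>B. (a b)\<^sup>2)" for a
  proof -
    have "expect \<eta> ((\<Sum>b\<in>B. a b *\<^sub>R b) * (\<Sum>b\<in>B. a b *\<^sub>R b))
        = (\<Sum>b\<in>B. \<Sum>c\<in>B. a b * a c * expect \<eta> (b * c))"
      by (simp add: sum_product expect_sum expect_scaleR mult_ac)
    also have "\<dots> = (\<Sum>b\<in>B. \<Sum>c\<in>B. if b = c then a b * a c else 0)"
      by (intro sum.cong refl) (simp add: ortho)
    finally show ?thesis by (simp add: fin power2_eq_square)
  qed
  have "(expect \<eta> (g * b) * exp (t * k b))\<^sup>2 \<le> (exp (- lam2 * t))\<^sup>2 * (expect \<eta> (g * b))\<^sup>2" if "b \<in> B" for b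
  proof (cases "k b = - lam")
    case True
    have "b = expect \<eta> (b * \<phi>) *\<^sub>R \<phi>"
      using ground_state_simple[of b] eig[OF that] True by simp
    hence "expect \<eta> (g * b) = 0"
      using orth by (metis expect_scaleR mult_scaleR_right mult_zero_right)
    thus ?thesis by simp
  next
    case False
    have "b \<noteq> 0" using ortho[OF that that] by (auto simp: expect_def)
    moreover have "(- Q) *v b = (- k b) *\<^sub>R b"
      using eig[OF that] by (simp add: uminus_matrix_vector_mult)
    ultimately have "- k b \<in> eigenvalues (- Q)"
      unfolding eigenvalues_def by blast
    hence "lam2 \<le> - k b" using gap False by force
    hence "t * k b \<le> - lam2 * t"
      using mult_left_mono[OF _ \<open>0 \<le> t\<close>, of "k b" "- lam2"] by (simp add: mult.commute)
    hence "(exp (t * k b))\<^sup>2 \<le> (exp (- lam2 * t))\<^sup>2"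
      by (intro power_mono) auto
    from mult_right_mono[OF this zero_le_power2[of "expect \<eta> (g * b)"]] show ?thesis
      by (simp add: power_mult_distrib mult.commute)
  qed
  hence "(\<Sum>b\<in>B. (expect \<eta> (g * b) * exp (t * k b))\<^sup>2) \<le> (\<Sum>b\<in>B. (exp (- lam2 * t))\<^sup>2 * (expect \<eta> (g * b))\<^sup>2)"
    by (rule sum_mono)
  also have "\<dots> = (exp (- lam2 * t))\<^sup>2 * expect \<eta> (g * g)"
    using sq[of "\<lambda>b. expect \<eta> (g * b)"] by (simp add: expand sum_distrib_left)
  finally show ?thesis
    by (simp only: semigroup_expand[OF eig expand] sq)
qed

section \<open>Identification of the quasi-stationary measure\<close>

definition qsm :: "real ^ 's" where
  "qsm = (1 / expect \<eta> \<phi>) *\<^sub>R (\<eta> * \<phi>)"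

lemma expect_ground_state_pos: "m \<in> prob_measures \<Longrightarrow> 0 < expect m \<phi>"
  using expect_pos \<phi>_pos by blast

lemma expect_qsm: "expect qsm f = expect \<eta> (f * \<phi>) / expect \<eta> \<phi>"
  by (simp add: expect_def qsm_def sum_divide_distrib mult_ac)

lemma vec_1_mult: "vec 1 * f = (f :: real ^ 's)"
  by (simp add: vec_eq_iff)

lemma qsm_prob: "qsm \<in> prob_measures"
proof -
  have "expect qsm (vec 1) = 1"
    using expect_ground_state_pos[OF \<eta>] by (simp add: expect_qsm vec_1_mult)
  moreover have "0 \<le> qsm $ x" for x
    using expect_ground_state_pos[OF \<eta>] \<eta>_pos \<phi>_pos by (simp add: qsm_def less_imp_le)
  ultimately show ?thesis by (simp add: prob_measures_def expect_def)
qed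

lemma expect_conditioned_law_semigroup:
  "expect (conditioned_law Q m t) f = expect m (killed_semigroup t f) / expect m (killed_semigroup t (vec 1))"
  by (simp add: expect_conditioned_law killed_semigroup_def)

lemma measure_eqI:
  fixes m n :: "real ^ 's"
  assumes "\<And>f. expect m f = expect n f"
  shows "m = n"
  using assms[of "axis y 1" for y] by (simp add: expect_axis vec_eq_iff)

text \<open>Numerator and denominator of the conditioned law both pick up the factor
  \<open>exp (- lam * t)\<close>, which cancels.\<close>

lemma qsm_quasi_stationary: "is_quasi_stationary Q qsm"
  unfolding is_quasi_stationary_def
proof (intro conjI allI impI qsm_prob measure_eqI)
  fix t f
  show "expect (conditioned_law Q qsm t) f = expect qsm f"
    using expect_ground_state_pos[OF \<eta>]
    by (simp add: expect_conditioned_law_semigroup expect_qsm expect_semigroup_ground_state vec_1_mult)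
qed

text \<open>As \<open>qsm\<close> is proportional to \<phi>\<eta>, mean zero under
  \<open>qsm\<close> is the same as orthogonality to \<phi> in L2(\<eta>).\<close>

lemma center_orthogonal: "expect \<eta> ((f - expect qsm f *\<^sub>R vec 1) * \<phi>) = 0"
  using expect_ground_state_pos[OF \<eta>]
  by (simp add: left_diff_distrib expect_diff expect_scaleR expect_qsm vec_1_mult)

text \<open>
  Testing the stationarity of \<open>n\<close> at time 1 on \<open>\<phi>\<close> gives the survival rate \<open>lam\<close>; testing it on
  any other eigenvector \<open>b\<close> then forces \<open>n[b] = 0\<close>.
\<close>

lemma quasi_stationary_unique:
  assumes "is_quasi_stationary Q n"
  shows "n = qsm"
proof -
  have n: "n \<in> prob_measures" "conditioned_law Q n 1 = n"
    using assms by (simp_all add: is_quasi_stationary_def)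
  have st: "expect n f = expect n (killed_semigroup 1 f) / expect n (killed_semigroup 1 (vec 1))" for f
    using expect_conditioned_law_semigroup[of n 1 f] n(2) by simp
  \<comment> \<open>A zero denominator would make the quotient 0 and contradict
    \<open>n[\<phi>] > 0\<close>.\<close>
  have D: "expect n (killed_semigroup 1 (vec 1)) = exp (- lam)"
    using st[of \<phi>] expect_ground_state_pos[OF n(1)]
    by (cases "expect n (killed_semigroup 1 (vec 1)) = 0")
       (auto simp: semigroup_ground_state expect_scaleR field_simps)
  obtain B k where fin: "finite B" and eig: "\<And>b. b \<in> B \<Longrightarrow> Q *v b = k b *\<^sub>R b"
      and ortho: "\<And>b c. b \<in> B \<Longrightarrow> c \<in> B \<Longrightarrow> expect \<eta> (b * c) = (if b = c then 1 else 0)"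
      and expand: "\<And>f. (\<Sum>b\<in>B. expect \<eta> (f * b) *\<^sub>R b) = f"
    by (rule eigenbasis) blast
  have zero: "expect n g = 0" if g: "expect \<eta> (g * \<phi>) = 0" for g
  proof -
    have "expect \<eta> (g * b) * expect n b = 0" if b: "b \<in> B" for b
    proof (cases "k b = - lam")
      case True
      have "b = expect \<eta> (b * \<phi>) *\<^sub>R \<phi>"
        using ground_state_simple[of b] eig[OF b] True by simp
      hence "expect \<eta> (g * b) = 0"
        using g by (metis expect_scaleR mult_scaleR_right mult_zero_right)
      thus ?thesis by simp
    next
      case False
      have "expect n b * exp (- lam) = exp (k b) * expect n b"
        using st[of b] D by (simp add: semigroup_eigenvector[OF eig[OF b]] expect_scaleR field_simps)
      thus ?thesis using False by auto
    qed
    hence "expect n (\<Sum>b\<in>B. expect \<eta> (g * b) *\<^sub>R b) = 0"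
      by (simp add: expect_sum expect_scaleR sum.neutral)
    thus ?thesis by (simp only: expand)
  qed
  \<comment> \<open>Both measures vanish on functions orthogonal to \<phi> and have mass 1, so they
    agree on \<open>f\<close>, split into its centered part and a constant.\<close>
  show ?thesis
  proof (rule measure_eqI)
    fix f
    show "expect n f = expect qsm f"
      using zero[OF center_orthogonal[of f]] by (simp add: expect_diff expect_scaleR expect_one n(1))
  qed
qed

lemma quasi_stationary_measure_eq: "quasi_stationary_measure Q = qsm"
  unfolding quasi_stationary_measure_def
  using qsm_quasi_stationary quasi_stationary_unique by (intro the_equality)

section \<open>Estimates for the ground state, the numerator and the denominator\<close>

lemma ground_state_Min_pos: "0 < (MIN x. \<phi> $ x)"
  using \<phi>_pos by (subst Min_gr_iff) auto

lemma ground_state_Min_le_1: "(MIN x. \<phi> $ x) \<le> 1"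
proof -
  let ?m = "MIN x. \<phi> $ x"
  have "?m * ?m = expect \<eta> (vec (?m * ?m))" by (simp add: expect_vec \<eta>)
  also have "\<dots> \<le> expect \<eta> (\<phi> * \<phi>)"
    using ground_state_Min_pos by (intro expect_mono[OF \<eta>]) (auto intro!: mult_mono simp: less_imp_le[OF \<phi>_pos])
  finally have "?m\<^sup>2 \<le> 1\<^sup>2" by (simp add: \<phi>_normalized power2_eq_square)
  thus ?thesis by (rule power2_le_imp_le) simp
qed

lemma ground_state_Max_ge_1: "1 \<le> (MAX x. \<phi> $ x)"
proof -
  let ?m = "MAX x. \<phi> $ x"
  have le: "\<phi> $ x \<le> ?m" for x by simp
  hence pos: "0 < ?m" using \<phi>_pos less_le_trans by blast
  have "expect \<eta> (\<phi> * \<phi>) \<le> expect \<eta> (vec (?m * ?m))"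
    using pos by (intro expect_mono[OF \<eta>]) (auto intro!: mult_mono less_imp_le[OF \<phi>_pos])
  hence "1\<^sup>2 \<le> ?m\<^sup>2" by (simp add: expect_vec \<eta> \<phi>_normalized power2_eq_square)
  thus ?thesis by (rule power2_le_imp_le) (rule less_imp_le[OF pos])
qed

text \<open>Expanding \<eta>[(\<phi> - 1)^2] \<ge> 0 with \<eta>[\<phi>^2] = 1.\<close>

lemma expect_ground_state_le_1: "expect \<eta> \<phi> \<le> 1"
proof -
  have "0 \<le> expect \<eta> ((\<phi> - vec 1) * (\<phi> - vec 1))"
    using \<eta> by (simp add: expect_def prob_measures_def sum_nonneg)
  also have "(\<phi> - vec 1) * (\<phi> - vec 1) = \<phi> * \<phi> - 2 *\<^sub>R \<phi> + vec 1"
    by (simp add: vec_eq_iff algebra_simps)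
  finally show ?thesis
    by (simp add: expect_add expect_diff expect_scaleR expect_one \<eta> \<phi>_normalized)
qed

text \<open>The variance of \<open>f\<close> under \<open>qsm\<close> is at most 1. Bounding the
  density \<phi> from below by its minimum passes from \<open>qsm\<close> to \<eta>.\<close>

lemma expect_center_square_le:
  assumes f: "\<And>x. \<bar>f $ x\<bar> \<le> 1"
  defines "g \<equiv> f - expect qsm f *\<^sub>R vec 1"
  shows "expect \<eta> (g * g) \<le> (1 / (MIN x. \<phi> $ x))\<^sup>2"
proof -
  let ?m = "MIN x. \<phi> $ x"
  have "g * g = f * f - (2 * expect qsm f) *\<^sub>R f + (expect qsm f)\<^sup>2 *\<^sub>R vec 1"
    by (simp add: g_def vec_eq_iff algebra_simps power2_eq_square)
  hence "expect qsm (g * g) = expect qsm (f * f) - (expect qsm f)\<^sup>2"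
    by (simp add: expect_add expect_diff expect_scaleR expect_one qsm_prob power2_eq_square)
  also have "\<dots> \<le> expect qsm (vec 1)"
  proof -
    have "expect qsm (f * f) \<le> expect qsm (vec 1)"
      using f by (intro expect_mono[OF qsm_prob]) (simp add: abs_square_le_1[unfolded power2_eq_square])
    thus ?thesis using zero_le_power2[of "expect qsm f"] by linarith
  qed
  finally have "expect \<eta> (g * g * \<phi>) \<le> expect \<eta> \<phi>"
    using expect_ground_state_pos[OF \<eta>] by (simp add: expect_vec qsm_prob) (simp add: expect_qsm)
  moreover have "expect \<eta> (?m *\<^sub>R (g * g)) \<le> expect \<eta> (g * g * \<phi>)"
    by (intro expect_mono[OF \<eta>]) (simp add: mult.commute mult_right_mono)
  ultimately have "?m * expect \<eta> (g * g) \<le> 1"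
    using expect_ground_state_le_1 by (simp add: expect_scaleR)
  hence "expect \<eta> (g * g) \<le> 1 / ?m"
    unfolding pos_le_divide_eq[OF ground_state_Min_pos] by (simp only: mult.commute)
  \<comment> \<open>Since \<open>1 / ?m \<ge> 1\<close>, squaring only enlarges it; the square gives
    the norm bound \<open>1 / ?m\<close> after taking roots.\<close>
  also have "\<dots> \<le> (1 / ?m)\<^sup>2"
    using le_divide_eq_1_pos[OF ground_state_Min_pos] ground_state_Min_le_1
    by (intro self_le_power) simp_all
  finally show ?thesis .
qed

lemma weight_Min_pos: "0 < (MIN x. (\<phi> $ x)\<^sup>2 * \<eta> $ x)"
  by (subst Min_gr_iff) (auto intro!: mult_pos_pos zero_less_power \<phi>_pos \<eta>_pos)

text \<open>The sum \<eta>[u^2] dominates its term at \<open>x\<close>. Keeping the factor \<phi>(x)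
  outside lets integration against a measure \<open>m\<close> produce \<open>m[\<phi>]\<close>,
  which cancels against the survival bound.\<close>

lemma pointwise_le_norm:
  "\<bar>u $ x\<bar> \<le> \<phi> $ x * sqrt (expect \<eta> (u * u) * (1 / (MIN x. (\<phi> $ x)\<^sup>2 * \<eta> $ x)))"
proof -
  let ?p = "MIN x. (\<phi> $ x)\<^sup>2 * \<eta> $ x"
  have p: "0 < ?p" by (rule weight_Min_pos)
  have "(u $ x)\<^sup>2 * ?p \<le> (u $ x)\<^sup>2 * ((\<phi> $ x)\<^sup>2 * \<eta> $ x)"
    by (intro mult_left_mono) auto
  also have "\<dots> = (\<phi> $ x)\<^sup>2 * (\<eta> $ x * (u * u) $ x)"
    by (simp add: power2_eq_square)
  also have "\<dots> \<le> (\<phi> $ x)\<^sup>2 * expect \<eta> (u * u)"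
    unfolding expect_def using \<eta>_pos
    by (intro mult_left_mono member_le_sum) (auto simp: less_imp_le)
  finally have "(u $ x)\<^sup>2 \<le> (\<phi> $ x)\<^sup>2 * (expect \<eta> (u * u) * (1 / ?p))"
    using p by (simp add: field_simps)
  from real_sqrt_le_mono[OF this] show ?thesis
    using \<phi>_pos[of x] by (simp only: real_sqrt_mult real_sqrt_abs abs_of_pos)
qed

text \<open>The semigroup preserves nonnegativity of the maximum of \<phi> minus \<phi>, and it acts
  on \<phi> by a scalar.\<close>

lemma survival_lower_bound:
  assumes "m \<in> prob_measures" "0 \<le> t"
  shows "exp (- lam * t) * expect m \<phi> \<le> (MAX x. \<phi> $ x) * expect m (killed_semigroup t (vec 1))"
proof -
  let ?M = "MAX x. \<phi> $ x"
  have "exp (- lam * t) * \<phi> $ x \<le> ?M * killed_semigroup t (vec 1) $ x" for x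
    using semigroup_nonneg[OF assms(2), of "?M *\<^sub>R vec 1 - \<phi>" x]
    by (simp add: semigroup_diff semigroup_scaleR semigroup_ground_state)
  hence "expect m (exp (- lam * t) *\<^sub>R \<phi>) \<le> expect m (?M *\<^sub>R killed_semigroup t (vec 1))"
    by (intro expect_mono[OF assms(1)]) simp
  thus ?thesis by (simp add: expect_scaleR)
qed

section \<open>Convergence in total variation\<close>

lemma conditioned_law_diff_le:
  assumes m: "m \<in> prob_measures" and t: "0 \<le> t" and f: "\<And>x. \<bar>f $ x\<bar> \<le> 1"
    and gap: "\<And>l. l \<in> eigenvalues (- Q) \<Longrightarrow> l \<noteq> lam \<Longrightarrow> lam2 \<le> l"
  shows "\<bar>expect (conditioned_law Q m t) f - expect qsm f\<bar>
    \<le> sqrt (1 / (MIN x. (\<phi> $ x)\<^sup>2 * \<eta> $ x)) * ((MAX x. \<phi> $ x) / (MIN x. \<phi> $ x)) * exp (- (lam2 - lam) * t)"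
proof -
  let ?p = "MIN x. (\<phi> $ x)\<^sup>2 * \<eta> $ x" and ?M = "MAX x. \<phi> $ x" and ?m = "MIN x. \<phi> $ x"
  define g where "g = f - expect qsm f *\<^sub>R vec 1"
  define u where "u = killed_semigroup t g"
  define D where "D = expect m (killed_semigroup t (vec 1))"
  \<comment> \<open>The three factors are the spectral decay, the bound on the norm of
    \<open>g\<close>, and the constant of the pointwise estimate.\<close>
  define C where "C = exp (- lam2 * t) * (1 / ?m) * sqrt (1 / ?p)"
  have p: "0 < ?p" by (rule weight_Min_pos)
  have m_pos: "0 < ?m" by (rule ground_state_Min_pos)
  have \<phi>m: "0 < expect m \<phi>" by (rule expect_ground_state_pos[OF m])
  have low: "exp (- lam * t) * expect m \<phi> \<le> ?M * D"
    unfolding D_def by (rule survival_lower_bound[OF m t])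
  have D: "0 < D"
    using low \<phi>m ground_state_Max_ge_1 by (smt (verit) exp_gt_zero mult_pos_pos mult_nonneg_nonpos)
  have "expect \<eta> (u * u) \<le> (exp (- lam2 * t))\<^sup>2 * expect \<eta> (g * g)"
    unfolding u_def g_def by (intro semigroup_contraction center_orthogonal t gap)
  also have "\<dots> \<le> (exp (- lam2 * t))\<^sup>2 * (1 / ?m)\<^sup>2"
    unfolding g_def by (intro mult_left_mono expect_center_square_le f) simp
  finally have "expect \<eta> (u * u) * (1 / ?p) \<le> (exp (- lam2 * t) * (1 / ?m))\<^sup>2 * (1 / ?p)"
    using p by (intro mult_right_mono) (simp_all only: power_mult_distrib zero_le_divide_1_iff less_imp_le)
  from real_sqrt_le_mono[OF this]
  have sq: "sqrt (expect \<eta> (u * u) * (1 / ?p)) \<le> C"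
    by (simp only: real_sqrt_mult C_def real_sqrt_abs abs_mult abs_divide abs_exp_cancel abs_one abs_of_pos[OF m_pos])
  have "\<bar>u $ x\<bar> \<le> C * \<phi> $ x" for x
    using pointwise_le_norm[of u x] mult_left_mono[OF sq less_imp_le[OF \<phi>_pos[of x]]]
    by (simp add: mult.commute)
  hence bounds: "u $ x \<le> (C *\<^sub>R \<phi>) $ x" "((- C) *\<^sub>R \<phi>) $ x \<le> u $ x" for x
    by (simp_all add: abs_le_iff) (smt (verit))
  have num: "\<bar>expect m u\<bar> \<le> C * expect m \<phi>"
    using expect_mono[OF m bounds(1)] expect_mono[OF m bounds(2)]
    unfolding expect_scaleR by linarith
  have C0: "0 \<le> C"
    unfolding C_def using m_pos p
    by (intro mult_nonneg_nonneg real_sqrt_ge_zero exp_ge_zero) (simp_all only: less_imp_le zero_le_divide_1_iff)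
  have "expect (conditioned_law Q m t) f - expect qsm f = expect m u / D"
    using D
    unfolding u_def g_def expect_conditioned_law_semigroup semigroup_diff semigroup_scaleR
      expect_diff expect_scaleR D_def[symmetric]
    by (simp add: field_simps)
  hence "\<bar>expect (conditioned_law Q m t) f - expect qsm f\<bar> \<le> C * expect m \<phi> / D"
    using num D by (simp add: abs_divide divide_right_mono)
  \<comment> \<open>The survival bound is solved for \<open>m[\<phi>]\<close>, so that
    \<open>D\<close> cancels whatever the initial law is.\<close>
  also have "expect m \<phi> \<le> exp (lam * t) * (?M * D)"
    using low by (simp add: exp_minus field_simps)
  hence "C * expect m \<phi> / D \<le> C * (exp (lam * t) * (?M * D)) / D"
    using C0 D by (intro divide_right_mono mult_left_mono) auto
  also have "\<dots> = sqrt (1 / ?p) * (?M / ?m) * (exp (lam * t) * exp (- lam2 * t))"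
    using D by (simp add: C_def mult_ac)
  also have "exp (lam * t) * exp (- lam2 * t) = exp (- (lam2 - lam) * t)"
    by (simp add: algebra_simps flip: exp_add)
  finally show ?thesis .
qed

lemma tv_norm_conditioned_law_le:
  assumes "m \<in> prob_measures" "0 \<le> t"
    and "\<And>l. l \<in> eigenvalues (- Q) \<Longrightarrow> l \<noteq> lam \<Longrightarrow> lam2 \<le> l"
  shows "tv_norm (conditioned_law Q m t - qsm)
    \<le> sqrt (1 / (MIN x. (\<phi> $ x)\<^sup>2 * \<eta> $ x)) * ((MAX x. \<phi> $ x) / (MIN x. \<phi> $ x)) * exp (- (lam2 - lam) * t)"
proof -
  define d where "d = conditioned_law Q m t - qsm"
  \<comment> \<open>The sign of the difference is a test function with values in [-1, 1] that
    attains the total variation norm.\<close>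
  define f :: "real ^ 's" where "f = (\<chi> x. sgn (d $ x))"
  have "tv_norm d = expect d f"
    by (simp add: tv_norm_def expect_def f_def abs_sgn)
  also have "\<dots> = expect (conditioned_law Q m t) f - expect qsm f"
    by (simp add: d_def expect_def left_diff_distrib sum_subtractf)
  also have "\<dots> \<le> \<bar>expect (conditioned_law Q m t) f - expect qsm f\<bar>"
    by simp
  also have "\<dots> \<le> sqrt (1 / (MIN x. (\<phi> $ x)\<^sup>2 * \<eta> $ x)) * ((MAX x. \<phi> $ x) / (MIN x. \<phi> $ x)) * exp (- (lam2 - lam) * t)"
    by (intro conditioned_law_diff_le assms) (simp add: f_def sgn_if)
  finally show ?thesis unfolding d_def .
qed

text \<open>The weight \<phi>^2 \<eta> is at least \<open>?m\<^sup>2 * ?h\<close>, which costs a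
  factor \<open>1 / ?m\<close> after the root; \<open>?M \<ge> 1\<close> turns this into a second
  ratio \<open>?M / ?m\<close>.\<close>

lemma rate_bound_le:
  "sqrt (1 / (MIN x. (\<phi> $ x)\<^sup>2 * \<eta> $ x)) * ((MAX x. \<phi> $ x) / (MIN x. \<phi> $ x))
    \<le> sqrt (1 / (MIN x. \<eta> $ x)) * ((MAX x. \<phi> $ x) / (MIN x. \<phi> $ x))\<^sup>2"
proof -
  let ?p = "MIN x. (\<phi> $ x)\<^sup>2 * \<eta> $ x" and ?M = "MAX x. \<phi> $ x" and ?m = "MIN x. \<phi> $ x"
    and ?h = "MIN x. \<eta> $ x"
  have h: "0 < ?h" using \<eta>_pos by (subst Min_gr_iff) auto
  note m = ground_state_Min_pos and M = ground_state_Max_ge_1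
  have "?m\<^sup>2 * ?h \<le> (\<phi> $ x)\<^sup>2 * \<eta> $ x" for x
    using h m by (intro mult_mono power_mono) (auto simp: less_imp_le[OF \<eta>_pos] less_imp_le[OF \<phi>_pos])
  hence "?m\<^sup>2 * ?h \<le> ?p" by (subst Min_ge_iff) auto
  hence "1 / ?p \<le> 1 / (?m\<^sup>2 * ?h)"
    using mult_pos_pos[OF weight_Min_pos mult_pos_pos[OF zero_less_power[OF m] h]]
    by (intro divide_left_mono) simp_all
  from real_sqrt_le_mono[OF this] have "sqrt (1 / ?p) \<le> sqrt (1 / ?h) * (1 / ?m)"
    by (simp add: real_sqrt_mult real_sqrt_divide abs_of_pos[OF m] mult.commute)
  also have "\<dots> \<le> sqrt (1 / ?h) * (?M / ?m)"
    using h m M by (intro mult_left_mono divide_right_mono real_sqrt_ge_zero) (simp_all only: less_imp_le zero_le_divide_1_iff)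
  finally have "sqrt (1 / ?p) * (?M / ?m) \<le> sqrt (1 / ?h) * (?M / ?m) * (?M / ?m)"
    using divide_pos_pos[OF less_le_trans[OF zero_less_one M] m] by (intro mult_right_mono) (simp_all only: less_imp_le)
  thus ?thesis by (simp add: power2_eq_square mult.assoc)
qed

end

section \<open>Transfer to the absorbed Markov process\<close>

theorem theorem3:
  fixes Lbar :: "real ^ ('s::finite) option ^ 's option" and L :: "real ^ 's ^ 's"
    and V \<eta> \<nu> \<phi> :: "real ^ 's" and lam\<^sub>1 lam\<^sub>2 t :: real
  assumes "2 \<le> CARD('s)"
    and "markov_generator Lbar" and "absorbing_state Lbar None"
    and "V = killing_rate Lbar" and "L = unkilled_generator Lbar"
    and "irreducible_generator L"
    and "\<eta> \<in> prob_measures" and "invariant_measure L \<eta>"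
    and "reversible_measure L \<eta>"
    and "\<nu> = quasi_stationary_measure (L - diag V)"
    and "lam\<^sub>1 = Min (eigenvalues (diag V - L))"
    and "lam\<^sub>2 = Min {l \<in> eigenvalues (diag V - L). lam\<^sub>1 < l}"
    and "\<And>x. 0 < \<phi> $ x" and "(L - diag V) *v \<phi> = - lam\<^sub>1 *\<^sub>R \<phi>"
    and "expect \<eta> (\<chi> x. (\<phi> $ x)\<^sup>2) = 1"
    and "0 \<le> t"
  shows "(SUP \<mu>\<^sub>0 \<in> prob_measures. ereal (tv_norm (conditioned_law (L - diag V) \<mu>\<^sub>0 t - \<nu>)))
           \<le> ereal (sqrt (1 / (MIN x. (\<phi> $ x)\<^sup>2 * \<eta> $ x)) * ((MAX x. \<phi> $ x) / (MIN x. \<phi> $ x))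
                     * exp (- (lam\<^sub>2 - lam\<^sub>1) * t))
       \<and> sqrt (1 / (MIN x. (\<phi> $ x)\<^sup>2 * \<eta> $ x)) * ((MAX x. \<phi> $ x) / (MIN x. \<phi> $ x))
             * exp (- (lam\<^sub>2 - lam\<^sub>1) * t)
           \<le> sqrt (1 / (MIN x. \<eta> $ x)) * ((MAX x. \<phi> $ x) / (MIN x. \<phi> $ x))\<^sup>2
             * exp (- (lam\<^sub>2 - lam\<^sub>1) * t)"
proof -
  define Q where "Q = L - diag V"
  have off: "Q $ x $ y = L $ x $ y" "0 \<le> Q $ x $ y" if "x \<noteq> y" for x y
    using that assms(2,5) by (simp_all add: Q_def diag_def unkilled_generator_def markov_generator_def)
  \<comment> \<open>Positive diagonal entries of \<open>L\<close> are loops, absorbed by the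
    reflexive closure.\<close>
  have sub: "{(u, v). 0 < L $ u $ v} \<subseteq> {(u, v). u \<noteq> v \<and> 0 < Q $ u $ v}\<^sup>*"
  proof clarify
    fix u v assume "0 < L $ u $ v"
    thus "(u, v) \<in> {(u, v). u \<noteq> v \<and> 0 < Q $ u $ v}\<^sup>*"
      using off(1)[of u v] by (cases "u = v") (auto intro: r_into_rtrancl)
  qed
  have irr: "(x, y) \<in> {(u, v). u \<noteq> v \<and> 0 < Q $ u $ v}\<^sup>*" for x y
    using assms(6) rtrancl_subset_rtrancl[OF sub] by (auto simp: irreducible_generator_def)
  have rev: "reversible_measure Q \<eta>"
    using assms(9) by (auto simp: reversible_measure_def Q_def diag_def right_diff_distrib)
  have norm: "expect \<eta> (\<phi> * \<phi>) = 1"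
    using assms(15) by (simp add: expect_def power2_eq_square)
  interpret killed_reversible Q \<eta> \<phi> lam\<^sub>1
    using off irr assms(7,13,14) irreducible_reversible_pos[OF assms(6,7,9)] rev norm
    by unfold_locales (auto simp: Q_def)
  have neg: "diag V - L = - Q" by (simp add: Q_def)
  \<comment> \<open>An eigenvalue other than \<open>lam\<^sub>1\<close> lies strictly above this
    minimum, hence in the set whose minimum is \<open>lam\<^sub>2\<close>.\<close>
  have gap: "lam\<^sub>2 \<le> l" if "l \<in> eigenvalues (- Q)" "l \<noteq> lam\<^sub>1" for l
  proof -
    have "lam\<^sub>1 \<le> l"
      unfolding assms(11) neg using finite_eigenvalues that(1) by (rule Min_le)
    thus ?thesis
      unfolding assms(12) neg using finite_eigenvalues that by (intro Min_le) auto
  qed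
  have "tv_norm (conditioned_law Q \<mu>\<^sub>0 t - \<nu>)
      \<le> sqrt (1 / (MIN x. (\<phi> $ x)\<^sup>2 * \<eta> $ x)) * ((MAX x. \<phi> $ x) / (MIN x. \<phi> $ x)) * exp (- (lam\<^sub>2 - lam\<^sub>1) * t)"
    if "\<mu>\<^sub>0 \<in> prob_measures" for \<mu>\<^sub>0
    using tv_norm_conditioned_law_le[OF that assms(16) gap]
    by (simp add: assms(10) quasi_stationary_measure_eq flip: Q_def)
  moreover note mult_right_mono[OF rate_bound_le, of "exp (- (lam\<^sub>2 - lam\<^sub>1) * t)"]
  ultimately show ?thesis
    by (auto intro!: SUP_least simp flip: Q_def)
qed

end
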